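(* Let $t=(t_1,\dots,t_N)\in\mathbb{C}^N\setminus\{0\}$, let $f=f_t:\mathbb{C}/\Gamma\to\mathbb{R}^4$ be the corresponding HSL torus, let $a=(a_1,\dots,a_N)\in\mathbb{C}^N$, and let $T=\mathcal{T}_f(a)$ be the Lagrangian vector field along $f$ given by $T=\frac{\partial}{\partial r}\big|_{r=0}f_{(t_1e^{ra_1},\dots,t_Ne^{ra_N})}$, $r\in\mathbb{R}$. Then $T$ is Hamiltonian along $f$ if and only if both of the real equations $$\sum_{j=1}^{N}\frac{\mathrm{Re}(a_j)|t_j|^2}{\prod_{k\neq j}|s_k-s_j|^2}=0,\qquad \sum_{j=1}^{N}\frac{\mathrm{Re}(s_j)}{\mathrm{Im}(s_j)}\,\frac{\mathrm{Re}(a_j)|t_j|^2}{\prod_{k\neq j}|s_k-s_j|^2}=0$$ are satisfied.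
   Context: $\mathbb{R}^4$ has its standard inner product and orthonormal basis $\varepsilon_1,\dots,\varepsilon_4$; $J,L\in SO(4)$ are given by $J\varepsilon_1=\varepsilon_2$, $J\varepsilon_2=-\varepsilon_1$, $J\varepsilon_3=\varepsilon_4$, $J\varepsilon_4=-\varepsilon_3$; $L\varepsilon_1=\varepsilon_3$, $L\varepsilon_3=-\varepsilon_1$, $L\varepsilon_2=-\varepsilon_4$, $L\varepsilon_4=\varepsilon_2$, extended complex linearly to $\mathbb{C}^4$; $\omega(X,Y)=JX\cdot Y$. Put $v_1=\frac1{\sqrt2}(\varepsilon_1-i\varepsilon_2)$. $\Gamma\subset\mathbb{C}$ is a lattice, $\langle z,w\rangle=\mathrm{Re}(z\bar w)$, $\Gamma^*=\{\gamma\in\mathbb{C}:\langle\gamma,z\rangle\in\mathbb{Z}\ \forall z\in\Gamma\}$, $e_\gamma(z)=\exp(2\pi i\langle\gamma,z\rangle)$. Fix $\beta_0\in\Gamma^*$ with $\Gamma^*_{\beta_0}=\{\gamma\in\Gamma^*+\frac{\beta_0}2:|\gamma|=\frac{|\beta_0|}2,\gamma\ne\pm\frac{\beta_0}2\}=\{\gamma_1,\dots,\gamma_N\}$ non-empty, labelled with $\gamma_{j+N/2}=-\gamma_j$; $s_j=2\gamma_j/\beta_0$ (distinct points of the unit circle, different from $\pm1$) and $p(\lambda)=\prod_{j=1}^N(\lambda-s_j)$. For $t\in\mathbb{C}^N$ let $$\varphi(\lambda,t)=\Big(\prod_{j=1}^N(\lambda-s_j)\Big)\det\begin{pmatrix}1&s_1&\dots&s_1^{N-2}&t_1/(\lambda-s_1)\\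 \vdots&\vdots&&\vdots&\vdots\\1&s_N&\dots&s_N^{N-2}&t_N/(\lambda-s_N)\end{pmatrix},$$ a polynomial in $\lambda$, and $\chi_1(\lambda,z)=\lambda\,\varphi(\lambda,t(z))$ where $t(z)=(t_1e_{-\gamma_1}(z),\dots,t_Ne_{-\gamma_N}(z))$. Then $f_t$ is the $\Gamma$-periodic map $$f_t(z)=2\,\mathrm{Re}\Big[\tfrac1{p(1)}\big(\chi_1(1,z)e_{\beta_0/2}(z)-\chi_1(1,0)\big)v_1\Big]+2\,\mathrm{Im}\Big[\tfrac1{p(1)}\big(\chi_1(-1,z)e_{-\beta_0/2}(z)-\chi_1(-1,0)\big)Lv_1\Big].$$ These are the based weakly conformal Hamiltonian stationary Lagrangian (HSL) tori with Maslov class $\beta_0$. For a map $f:M\to\mathbb{R}^4$ and a section $T$ of $f^{-1}T\mathbb{R}^4$, put $\sigma_T=f^*(T\rfloor\omega)=JT\cdot df$. $T$ is a Lagrangian vector field along $f$ if $\sigma_T$ is closed, and is Hamiltonian along $f$ if $\sigma_T$ is exact on $M$ (here $M=\mathbb{C}/\Gamma$). *)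

theory Defs
  imports "Jordan_Normal_Form.Determinant" "HOL-Analysis.Analysis"
begin

hide_const (open) Matrix.vec_index
no_notation Matrix.vec_index (infixl "$" 100)

text \<open>
  \<open>J\<close> and \<open>L\<close> are given in coordinates, polymorphically in the scalars: at type \<open>real ^ 4\<close> they are
  the elements of SO(4), at type \<open>complex ^ 4\<close> their complex linear extensions. The lemmas below
  give their values on the standard basis.
\<close>

definition J :: "'a::ring_1 ^ 4 \<Rightarrow> 'a ^ 4" where
  "J x = vector [- (x $ 2), x $ 1, - (x $ 4), x $ 3]"

definition L :: "'a::ring_1 ^ 4 \<Rightarrow> 'a ^ 4" where
  "L x = vector [- (x $ 3), x $ 4, x $ 1, - (x $ 2)]"

lemma vector_4_nth:
  "(vector [x, y, z, w] :: 'a::zero ^ 4) $ 1 = x"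
  "(vector [x, y, z, w] :: 'a ^ 4) $ 2 = y"
  "(vector [x, y, z, w] :: 'a ^ 4) $ 3 = z"
  "(vector [x, y, z, w] :: 'a ^ 4) $ 4 = w"
  by (simp_all add: vector_def)

lemma J_basis:
  "J (axis 1 1) = axis 2 1" "J (axis 2 1) = - axis 1 1"
  "J (axis 3 1) = axis 4 1" "J (axis 4 1) = - axis 3 1"
  by (simp_all add: J_def vec_eq_iff forall_4 axis_def vector_4_nth)

lemma L_basis:
  "L (axis 1 1) = axis 3 1" "L (axis 3 1) = - axis 1 1"
  "L (axis 2 1) = - axis 4 1" "L (axis 4 1) = axis 2 1"
  by (simp_all add: L_def vec_eq_iff forall_4 axis_def vector_4_nth)

definition omega :: "real ^ 4 \<Rightarrow> real ^ 4 \<Rightarrow> real" where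
  "omega X Y = inner (J X) Y"

definition v1 :: "complex ^ 4" where
  "v1 = (1 / complex_of_real (sqrt 2)) *s (axis 1 1 - \<i> *s axis 2 1)"

definition Re_vec :: "complex ^ 4 \<Rightarrow> real ^ 4" where
  "Re_vec v = (\<chi> k. Re (v $ k))"

definition Im_vec :: "complex ^ 4 \<Rightarrow> real ^ 4" where
  "Im_vec v = (\<chi> k. Im (v $ k))"


definition is_lattice :: "complex set \<Rightarrow> bool" where
  "is_lattice \<Gamma> \<longleftrightarrow> (\<exists>w1 w2. w1 \<noteq> w2 \<and> independent {w1, w2} \<and>
     \<Gamma> = {of_int m * w1 + of_int n * w2 | m n. True})"

definition pairing :: "complex \<Rightarrow> complex \<Rightarrow> real" where
  "pairing z w = Re (z * cnj w)"

definition dual_lattice :: "complex set \<Rightarrow> complex set" where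
  "dual_lattice \<Gamma> = {\<gamma>. \<forall>z\<in>\<Gamma>. pairing \<gamma> z \<in> \<int>}"

definition e :: "complex \<Rightarrow> complex \<Rightarrow> complex" where
  "e \<gamma> z = exp (2 * complex_of_real pi * \<i> * complex_of_real (pairing \<gamma> z))"

definition frequencies :: "complex set \<Rightarrow> complex \<Rightarrow> complex set" where
  "frequencies \<Gamma> \<beta>0 = {\<gamma>. (\<exists>\<delta>\<in>dual_lattice \<Gamma>. \<gamma> = \<delta> + \<beta>0 / 2) \<and>
     cmod \<gamma> = cmod \<beta>0 / 2 \<and> \<gamma> \<noteq> \<beta>0 / 2 \<and> \<gamma> \<noteq> - (\<beta>0 / 2)}"

text \<open>
  \<open>N\<close>-tuples are functions on \<open>nat\<close> of which only the values at \<open>1, \<dots>, N\<close> are used.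
\<close>

definition frequency_labelling ::
    "complex set \<Rightarrow> complex \<Rightarrow> nat \<Rightarrow> (nat \<Rightarrow> complex) \<Rightarrow> bool" where
  "frequency_labelling \<Gamma> \<beta>0 N \<gamma> \<longleftrightarrow>
     bij_betw \<gamma> {1..N} (frequencies \<Gamma> \<beta>0) \<and>
     (\<forall>j\<in>{1..N div 2}. \<gamma> (j + N div 2) = - \<gamma> j)"

definition spec :: "complex \<Rightarrow> (nat \<Rightarrow> complex) \<Rightarrow> nat \<Rightarrow> complex" where
  "spec \<beta>0 \<gamma> j = 2 * \<gamma> j / \<beta>0"

definition spec_poly :: "nat \<Rightarrow> (nat \<Rightarrow> complex) \<Rightarrow> complex \<Rightarrow> complex" where
  "spec_poly N s x = (\<Prod>j=1..N. x - s j)"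

text \<open>
  Rows and columns of \<open>mat\<close> are numbered from 0, hence the shift in the row index. For \<open>x\<close> equal to
  some \<open>s j\<close> the formula below divides by zero and does not give the value of the polynomial; it is
  only used at \<open>x = 1\<close> and \<open>x = -1\<close>, which are not among the \<open>s j\<close>.
\<close>

definition phi ::
    "nat \<Rightarrow> (nat \<Rightarrow> complex) \<Rightarrow> complex \<Rightarrow> (nat \<Rightarrow> complex) \<Rightarrow> complex" where
  "phi N s x t = spec_poly N s x *
     Determinant.det (Matrix.mat N N (\<lambda>(i, k).
       if k < N - 1 then s (i + 1) ^ k else t (i + 1) / (x - s (i + 1))))"

definition chi1 ::
    "complex \<Rightarrow> nat \<Rightarrow> (nat \<Rightarrow> complex) \<Rightarrow> (nat \<Rightarrow> complex) \<Rightarrow> complex \<Rightarrow> complex \<Rightarrow> complex" where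
  "chi1 \<beta>0 N \<gamma> t x z = x * phi N (spec \<beta>0 \<gamma>) x (\<lambda>j. t j * e (- \<gamma> j) z)"

definition hsl_torus ::
    "complex \<Rightarrow> nat \<Rightarrow> (nat \<Rightarrow> complex) \<Rightarrow> (nat \<Rightarrow> complex) \<Rightarrow> complex \<Rightarrow> real ^ 4" where
  "hsl_torus \<beta>0 N \<gamma> t z =
     2 *\<^sub>R Re_vec ((1 / spec_poly N (spec \<beta>0 \<gamma>) 1 *
       (chi1 \<beta>0 N \<gamma> t 1 z * e (\<beta>0 / 2) z - chi1 \<beta>0 N \<gamma> t 1 0)) *s v1) +
     2 *\<^sub>R Im_vec ((1 / spec_poly N (spec \<beta>0 \<gamma>) 1 *
       (chi1 \<beta>0 N \<gamma> t (- 1) z * e (- (\<beta>0 / 2)) z - chi1 \<beta>0 N \<gamma> t (- 1) 0)) *s L v1)"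

definition variation ::
    "complex \<Rightarrow> nat \<Rightarrow> (nat \<Rightarrow> complex) \<Rightarrow> (nat \<Rightarrow> complex) \<Rightarrow> (nat \<Rightarrow> complex) \<Rightarrow>
     complex \<Rightarrow> real ^ 4" where
  "variation \<beta>0 N \<gamma> t a z =
     vector_derivative (\<lambda>r::real. hsl_torus \<beta>0 N \<gamma> (\<lambda>j. t j * exp (complex_of_real r * a j)) z) (at 0)"


text \<open>
  Maps and differential forms on the torus \<open>\<complex>/\<Gamma>\<close> are represented by their \<open>\<Gamma>\<close>-periodic lifts to
  \<open>\<complex>\<close>, regarded as a real vector space. A 1-form \<open>\<sigma>\<close> sends a point and a tangent vector to a real
  number. A section of \<open>f\<^sup>-\<^sup>1 T\<real>\<^sup>4\<close> is a map from the torus to \<open>\<real>\<^sup>4\<close>.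
\<close>

definition torus_map :: "complex set \<Rightarrow> (complex \<Rightarrow> 'b::real_normed_vector) \<Rightarrow> bool" where
  "torus_map \<Gamma> F \<longleftrightarrow>
     (\<forall>z. F differentiable (at z)) \<and> (\<forall>z. \<forall>w\<in>\<Gamma>. F (z + w) = F z)"

definition sigma_form ::
    "(complex \<Rightarrow> real ^ 4) \<Rightarrow> (complex \<Rightarrow> real ^ 4) \<Rightarrow> complex \<Rightarrow> complex \<Rightarrow> real" where
  "sigma_form f T z X = omega (T z) (frechet_derivative f (at z) X)"

text \<open>
  Closedness is \<open>d\<sigma>(X, Y) = X(\<sigma>(Y)) - Y(\<sigma>(X)) = 0\<close> for constant vector fields \<open>X\<close> and \<open>Y\<close>, which
  commute.
\<close>

definition closed_form :: "(complex \<Rightarrow> complex \<Rightarrow> real) \<Rightarrow> bool" where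
  "closed_form \<sigma> \<longleftrightarrow>
     (\<forall>z X. (\<lambda>w. \<sigma> w X) differentiable (at z)) \<and>
     (\<forall>z X Y. frechet_derivative (\<lambda>w. \<sigma> w Y) (at z) X - frechet_derivative (\<lambda>w. \<sigma> w X) (at z) Y = 0)"

text \<open>
  Smoothness of the primitive is not required: a primitive of a smooth form is smooth.
\<close>

definition exact_on_torus :: "complex set \<Rightarrow> (complex \<Rightarrow> complex \<Rightarrow> real) \<Rightarrow> bool" where
  "exact_on_torus \<Gamma> \<sigma> \<longleftrightarrow>
     (\<exists>h :: complex \<Rightarrow> real. torus_map \<Gamma> h \<and> (\<forall>z. (h has_derivative \<sigma> z) (at z)))"

definition lagrangian_along ::
    "complex set \<Rightarrow> (complex \<Rightarrow> real ^ 4) \<Rightarrow> (complex \<Rightarrow> real ^ 4) \<Rightarrow> bool" where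
  "lagrangian_along \<Gamma> f T \<longleftrightarrow>
     torus_map \<Gamma> f \<and> torus_map \<Gamma> T \<and> closed_form (sigma_form f T)"

definition hamiltonian_along ::
    "complex set \<Rightarrow> (complex \<Rightarrow> real ^ 4) \<Rightarrow> (complex \<Rightarrow> real ^ 4) \<Rightarrow> bool" where
  "hamiltonian_along \<Gamma> f T \<longleftrightarrow>
     torus_map \<Gamma> f \<and> torus_map \<Gamma> T \<and> exact_on_torus \<Gamma> (sigma_form f T)"

end

theory Submission
  imports Defs
begin

text \<open>
  The proof computes the form \<open>\<sigma> = JT \<cdot> df\<close> in Fourier series and reads its periods off the constant term.

  In the coordinates \<open>from_C2\<close> the torus is a pair \<open>(F, G)\<close> of trigonometric polynomials. The
  determinant defining \<open>\<phi>\<close> is a divided difference (\<open>ex_det_eq_divided_difference\<close>), so with \<open>b = \<beta>0 / 2\<close>,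
  \<open>\<gamma>\<^sub>j = b s\<^sub>j\<close> and \<open>d\<^sub>j = V t\<^sub>j / \<Prod>\<^sub>k\<^sub>\<noteq>\<^sub>j (s\<^sub>j - s\<^sub>k)\<close> one has, up to additive constants,
  \<open>F = \<Sum> d\<^sub>j / (1 - s\<^sub>j) e(b - \<gamma>\<^sub>j)\<close> and \<open>G = q \<Sum> d\<^sub>j / (1 + s\<^sub>j) e(-b - \<gamma>\<^sub>j)\<close> with \<open>|q| = 1\<close>.
  The variation \<open>T\<close> corresponds to the pair \<open>(F', G')\<close> obtained by replacing \<open>d\<^sub>j\<close> with \<open>a\<^sub>j d\<^sub>j\<close>, and
  \<open>\<sigma> = 2 Im (cnj F' dF - cnj G' dG)\<close>.

  Expanding the products, the index pair \<open>(j, k)\<close> contributes a covector times \<open>e(\<gamma>\<^sub>j - \<gamma>\<^sub>k)\<close>. For \<open>j \<noteq> k\<close>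
  the contributions of the two planes add up to a multiple of the differential of this
  exponential, because the \<open>s\<^sub>j\<close> lie on the unit circle (\<open>resonance_off_diagonal\<close>). For \<open>j = k\<close> they add
  up to a parallel form (\<open>resonance_diagonal\<close>). The additive constants of \<open>F'\<close> and \<open>G'\<close> contribute
  multiples of \<open>dF\<close> and \<open>dG\<close>. Hence \<open>\<sigma>\<close> is the differential of a \<open>\<Gamma>\<close>-periodic function plus the
  parallel form \<open>\<langle>\<zeta>, \<cdot>\<rangle>\<close> with
  \<open>\<zeta> = 4 \<pi> b \<Sum> Re a\<^sub>j |d\<^sub>j|\<^sup>2 (1 - \<i> Re s\<^sub>j / Im s\<^sub>j)\<close>.
  Such a form is closed, and it is exact on the torus precisely when \<open>\<zeta> = 0\<close> (\<open>exact_on_torus_iff\<close>).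
  The real and imaginary parts of \<open>\<zeta> / (4 \<pi> b |V|\<^sup>2)\<close> are the two sums of the theorem, the second
  one with a minus sign.
\<close>

section \<open>The symplectic form in complex coordinates\<close>

text \<open>
  The identification \<open>\<complex>\<^sup>2 = \<real>\<^sup>4\<close> adapted to the frame \<open>v1\<close>, \<open>L v1\<close>. The second plane is
  traversed with its coordinates swapped, because the torus takes an imaginary part there; this is
  why the symplectic form below is a difference of two area forms instead of a sum.
\<close>

definition from_C2 :: "complex \<Rightarrow> complex \<Rightarrow> real ^ 4" where
  "from_C2 u v = sqrt 2 *\<^sub>R vector [Re u, Im u, Im v, Re v]"

lemma omega_from_C2:
  "omega (from_C2 u v) (from_C2 u' v') = 2 * Im (cnj u * u' - cnj v * v')"
  by (simp add: omega_def from_C2_def J_def inner_vec_def sum_4 vector_4_nth algebra_simps)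

lemma bounded_linear_from_C2: "bounded_linear (\<lambda>p. from_C2 (fst p) (snd p))"
proof -
  have "linear (\<lambda>p. from_C2 (fst p) (snd p))"
    by (rule linearI) (simp_all add: from_C2_def vec_eq_iff forall_4 vector_4_nth algebra_simps)
  then show ?thesis by (rule linear_conv_bounded_linear[THEN iffD1])
qed

lemma Re_Im_vec_frame_eq_from_C2:
  "2 *\<^sub>R Re_vec (u *s v1) + 2 *\<^sub>R Im_vec (v *s L v1) = from_C2 u v"
proof -
  have [simp]: "2 * x / sqrt 2 = sqrt 2 * x" for x :: real
    by (simp add: real_div_sqrt field_simps)
  show ?thesis
    by (simp add: vec_eq_iff forall_4 from_C2_def Re_vec_def Im_vec_def L_def v1_def vector_4_nth axis_def
        Re_divide Im_divide Re_divide_of_real Im_divide_of_real)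
qed

section \<open>Trigonometric polynomials on the torus\<close>

text \<open>
  Complexifying the real pairing separates its parts linear in \<open>X\<close> and in \<open>cnj X\<close>, which can then
  be compared coefficient by coefficient.
\<close>

lemma pairing_of_real: "complex_of_real (pairing z w) = (z * cnj w + cnj z * w) / 2"
  by (simp add: pairing_def complex_eq_iff)

lemma bounded_linear_pairing: "bounded_linear (pairing z)"
  unfolding pairing_def
  by (intro bounded_linear_compose[OF bounded_linear_Re]
      bounded_linear_compose[OF bounded_linear_mult_right] bounded_linear_cnj)

lemma pairing_diff: "pairing (u - v) X = pairing u X - pairing v X"
  by (simp add: pairing_def algebra_simps)

lemma pairing_divide: "pairing (u / complex_of_real r) X = pairing u X / r"
  by (simp add: pairing_def Re_divide_of_real Im_divide_of_real add_divide_distrib)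

lemma pairing_of_real_combination:
  "pairing (of_real k * b * (\<Sum>j\<in>I. of_real (r j) * v j)) X = (\<Sum>j\<in>I. k * (r j * pairing (b * v j) X))"
proof -
  have "of_real k * b * (\<Sum>j\<in>I. of_real (r j) * v j) * cnj X
      = (\<Sum>j\<in>I. of_real (k * r j) * (b * v j * cnj X))"
    by (simp add: sum_distrib_left sum_distrib_right mult_ac)
  moreover have "Re (of_real x * w) = x * Re w" for x w by simp
  ultimately show ?thesis by (simp only: pairing_def Re_sum mult.assoc)
qed

lemma e_add: "e (\<gamma> + \<delta>) z = e \<gamma> z * e \<delta> z"
  by (simp add: e_def pairing_def ring_distribs exp_add)

lemma e_zero: "e 0 z = 1" "e \<gamma> 0 = 1" by (simp_all add: e_def pairing_def)

lemma cnj_e: "cnj (e \<gamma> z) = e (- \<gamma>) z"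
  by (simp add: e_def pairing_def algebra_simps exp_cnj)

lemma has_derivative_e:
  "(e \<gamma> has_derivative (\<lambda>X. 2 * pi * \<i> * pairing \<gamma> X * e \<gamma> z)) (at z)"
proof -
  have "((\<lambda>z. 2 * pi * \<i> * complex_of_real (pairing \<gamma> z)) has_derivative
      (\<lambda>X. 2 * pi * \<i> * complex_of_real (pairing \<gamma> X))) (at z)"
    by (intro bounded_linear_imp_has_derivative bounded_linear_compose[OF bounded_linear_mult_right]
        bounded_linear_compose[OF bounded_linear_of_real] bounded_linear_pairing)
  from has_derivative_compose[OF this DERIV_exp[THEN has_field_derivative_imp_has_derivative]]
  show ?thesis unfolding e_def by (simp add: mult_ac)
qed

lemma e_periodic:
  assumes "\<gamma> \<in> dual_lattice \<Gamma>" "w \<in> \<Gamma>"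
  shows "e \<gamma> (z + w) = e \<gamma> z"
proof -
  have "pairing \<gamma> w \<in> \<int>" using assms by (simp add: dual_lattice_def)
  then obtain n where n: "pairing \<gamma> w = of_int n" by (auto elim: Ints_cases)
  have "e \<gamma> (z + w) = e \<gamma> z * e \<gamma> w"
    by (simp add: e_def pairing_def ring_distribs exp_add)
  also have "e \<gamma> w = 1" unfolding e_def n using exp_integer_2pi[of "of_int n"] by (simp add: mult_ac)
  finally show ?thesis by simp
qed

lemma dual_lattice_diff: "\<gamma> \<in> dual_lattice \<Gamma> \<Longrightarrow> \<delta> \<in> dual_lattice \<Gamma> \<Longrightarrow> \<gamma> - \<delta> \<in> dual_lattice \<Gamma>"
  by (auto simp: dual_lattice_def pairing_def left_diff_distrib Ints_diff simp del: times_complex.sel)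

lemma dual_lattice_minus: "\<gamma> \<in> dual_lattice \<Gamma> \<Longrightarrow> - \<gamma> \<in> dual_lattice \<Gamma>"
  by (auto simp: dual_lattice_def pairing_def simp del: times_complex.sel)

definition trig_poly ::
    "'i set \<Rightarrow> ('i \<Rightarrow> complex) \<Rightarrow> ('i \<Rightarrow> complex) \<Rightarrow> complex \<Rightarrow> complex" where
  "trig_poly I c \<delta> z = (\<Sum>i\<in>I. c i * e (\<delta> i) z)"

text \<open>
  The differential of \<open>trig_poly\<close>. The index set \<open>I\<close> is kept apart from the frequencies \<open>\<delta>\<close>, so that
  double sums in which a frequency occurs repeatedly need no regrouping.
\<close>

definition trig_form ::
    "'i set \<Rightarrow> ('i \<Rightarrow> complex) \<Rightarrow> ('i \<Rightarrow> complex) \<Rightarrow> complex \<Rightarrow> complex \<Rightarrow> complex" where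
  "trig_form I c \<delta> z X = (\<Sum>i\<in>I. c i * (2 * pi * \<i> * pairing (\<delta> i) X * e (\<delta> i) z))"

lemma has_derivative_trig_poly:
  "(trig_poly I c \<delta> has_derivative trig_form I c \<delta> z) (at z)"
  unfolding trig_poly_def trig_form_def
  by (intro has_derivative_sum has_derivative_mult_right has_derivative_e)

lemma trig_poly_periodic:
  assumes "\<And>i. i \<in> I \<Longrightarrow> \<delta> i \<in> dual_lattice \<Gamma>" "w \<in> \<Gamma>"
  shows "trig_poly I c \<delta> (z + w) = trig_poly I c \<delta> z"
  unfolding trig_poly_def by (intro sum.cong) (simp_all add: e_periodic[OF assms])

lemma trig_form_scale: "k * trig_form I c \<delta> z X = trig_form I (\<lambda>i. k * c i) \<delta> z X"
  by (simp add: trig_form_def sum_distrib_left mult.assoc)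

lemma has_vector_derivative_trig_poly_exp:
  "((\<lambda>r::real. trig_poly I (\<lambda>j. u j * exp (of_real r * a j)) \<delta> z) has_vector_derivative
     trig_poly I (\<lambda>j. a j * u j) \<delta> z) (at 0)"
proof -
  have "((\<lambda>r::real. exp (of_real r * w)) has_vector_derivative w) (at 0)" for w :: complex
    using exp_scaleR_has_vector_derivative_right[of w 0 UNIV] by (simp add: scaleR_conv_of_real)
  then have "((\<lambda>r::real. \<Sum>j\<in>I. u j * e (\<delta> j) z * exp (of_real r * a j)) has_vector_derivative
      (\<Sum>j\<in>I. u j * e (\<delta> j) z * a j)) (at 0)"
    by (intro has_vector_derivative_sum has_vector_derivative_mult_right)
  then show ?thesis by (simp add: trig_poly_def mult_ac)
qed

section \<open>Closed and exact forms\<close>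

lemma closed_form_add:
  assumes "closed_form \<sigma>" "closed_form \<tau>"
  shows "closed_form (\<lambda>z X. \<sigma> z X + \<tau> z X)"
proof -
  have d: "(\<lambda>w. \<sigma> w X) differentiable (at z)" "(\<lambda>w. \<tau> w X) differentiable (at z)" for z X
    using assms by (auto simp: closed_form_def)
  then have "frechet_derivative (\<lambda>w. \<sigma> w X + \<tau> w X) (at z) =
      (\<lambda>Y. frechet_derivative (\<lambda>w. \<sigma> w X) (at z) Y + frechet_derivative (\<lambda>w. \<tau> w X) (at z) Y)" for z X
    by (intro frechet_derivative_at[symmetric] has_derivative_add) (simp_all add: frechet_derivative_works)
  with d assms show ?thesis by (simp add: closed_form_def algebra_simps)
qed

lemma closed_form_parallel: "closed_form (\<lambda>z X. \<Lambda> X)"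
  by (simp add: closed_form_def frechet_derivative_const)

text \<open>
  The second derivatives are symmetric by inspection: differentiating \<open>trig_form\<close> in the direction
  \<open>Y\<close> multiplies each term by a further \<open>2 * pi * \<i> * pairing (\<delta> i) Y\<close>.
\<close>

lemma closed_form_Im_trig_form: "closed_form (\<lambda>z X. Im (trig_form I c \<delta> z X))"
proof -
  have d: "((\<lambda>w. Im (trig_form I c \<delta> w X)) has_derivative
     (\<lambda>Y. Im (\<Sum>i\<in>I. c i * (2 * pi * \<i> * pairing (\<delta> i) X * (2 * pi * \<i> * pairing (\<delta> i) Y * e (\<delta> i) z))))) (at z)" for X z
    unfolding trig_form_def
    by (intro has_derivative_Im has_derivative_sum has_derivative_mult_right has_derivative_e)
  have "frechet_derivative (\<lambda>w. Im (trig_form I c \<delta> w X)) (at z) =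
     (\<lambda>Y. Im (\<Sum>i\<in>I. c i * (2 * pi * \<i> * pairing (\<delta> i) X * (2 * pi * \<i> * pairing (\<delta> i) Y * e (\<delta> i) z))))" for X z
    by (rule frechet_derivative_at[OF d, symmetric])
  moreover have "(\<lambda>w. Im (trig_form I c \<delta> w X)) differentiable (at z)" for X z
    using d differentiable_def by blast
  ultimately show ?thesis by (simp add: closed_form_def mult_ac)
qed

text \<open>
  A lattice contains a basis of \<open>\<complex>\<close> over \<open>\<real>\<close>, so \<open>\<zeta>\<close> is orthogonal to itself.
\<close>

lemma pairing_eq_0_on_lattice:
  assumes "is_lattice \<Gamma>" "\<And>w. w \<in> \<Gamma> \<Longrightarrow> pairing \<zeta> w = 0"
  shows "\<zeta> = 0"
proof -
  obtain w1 w2 where w: "w1 \<noteq> w2" "independent {w1, w2}"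
    and G: "\<Gamma> = {of_int m * w1 + of_int n * w2 | m n. True}"
    using assms(1) by (auto simp: is_lattice_def)
  have "of_int 1 * w1 + of_int 0 * w2 \<in> \<Gamma>" "of_int 0 * w1 + of_int 1 * w2 \<in> \<Gamma>"
    unfolding G by blast+
  then have w0: "pairing \<zeta> w1 = 0" "pairing \<zeta> w2 = 0" using assms(2) by auto
  have "UNIV \<subseteq> span {w1, w2}"
    by (rule card_ge_dim_independent) (use w in auto)
  then have "\<zeta> \<in> span {w1, w2}" by blast
  then have "pairing \<zeta> \<zeta> = 0"
    by (rule linear_eq_0_on_span[OF bounded_linear.linear[OF bounded_linear_pairing], rotated])
      (use w0 in auto)
  then show ?thesis by (simp add: pairing_def complex_eq_iff sum_power2_eq_zero_iff flip: power2_eq_square)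
qed

text \<open>
  The periods of \<open>\<sigma>\<close> are those of its parallel part. A periodic primitive of \<open>\<sigma>\<close> differs from
  \<open>pairing \<zeta> + g\<close> by a constant, and then \<open>pairing \<zeta>\<close> itself is \<open>\<Gamma>\<close>-periodic, so it vanishes on \<open>\<Gamma>\<close>.
\<close>

lemma exact_on_torus_iff:
  assumes lat: "is_lattice \<Gamma>"
    and \<sigma>: "\<And>z. \<sigma> z = (\<lambda>X. pairing \<zeta> X + g' z X)"
    and g: "\<And>z. (g has_derivative g' z) (at z)" and per: "\<And>z w. w \<in> \<Gamma> \<Longrightarrow> g (z + w) = g z"
  shows "exact_on_torus \<Gamma> \<sigma> \<longleftrightarrow> \<zeta> = 0"
proof
  assume "\<zeta> = 0"
  then have "\<sigma> = g'" using \<sigma> by (auto simp: pairing_def)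
  then show "exact_on_torus \<Gamma> \<sigma>"
    unfolding exact_on_torus_def torus_map_def using g per
    by (intro exI[of _ g]) (auto simp: differentiable_def)
next
  assume "exact_on_torus \<Gamma> \<sigma>"
  then obtain h where h: "\<And>z w. w \<in> \<Gamma> \<Longrightarrow> h (z + w) = h z" "\<And>z. (h has_derivative \<sigma> z) (at z)"
    by (auto simp: exact_on_torus_def torus_map_def)
  have "((\<lambda>z. h z - (pairing \<zeta> z + g z)) has_derivative (\<lambda>_. 0)) (at z)" for z
    by (rule has_derivative_eq_rhs[OF has_derivative_diff[OF h(2)
          has_derivative_add[OF bounded_linear_imp_has_derivative[OF bounded_linear_pairing] g]]])
      (simp add: \<sigma>)
  then obtain c where c: "\<And>z. h z - (pairing \<zeta> z + g z) = c"
    using has_derivative_zero_constant[of UNIV "\<lambda>z. h z - (pairing \<zeta> z + g z)"] by auto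
  have "pairing \<zeta> w = 0" if "w \<in> \<Gamma>" for w
    using c[of w] c[of 0] h(1)[OF that, of 0] per[OF that, of 0] by (simp add: pairing_def)
  with lat show "\<zeta> = 0" by (rule pairing_eq_0_on_lattice)
qed

section \<open>The symplectic pairing of two resonant planes\<close>

text \<open>
  The reason why the mixed terms are exact. The covector in front of \<open>e (\<gamma>\<^sub>i - \<gamma>\<^sub>k)\<close> must be a
  multiple of the differential of that exponential. The variables \<open>b'\<close>, \<open>X\<close>, \<open>Y\<close> stand for
  \<open>cnj b\<close>, \<open>X\<close>, \<open>cnj X\<close>, and \<open>1 / s\<close>, \<open>1 / r\<close> for the conjugates of unimodular \<open>s\<close>, \<open>r\<close>; both sides turn
  out to be proportional to \<open>b * Y - b' * X / (s * r)\<close>.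
\<close>

lemma resonance_off_diagonal:
  fixes b b' s r X Y :: complex
  assumes "s \<noteq> 0" "r \<noteq> 0" "s \<noteq> r" "1 - s \<noteq> 0" "1 + s \<noteq> 0" "1 - r \<noteq> 0" "1 + r \<noteq> 0"
  shows "1 / (1 - 1/s) * (1 / (1 - r)) * (((b - b * r) * Y + (b' - b' * (1/r)) * X) / 2)
       - 1 / (1 + 1/s) * (1 / (1 + r)) * (((- b - b * r) * Y + (- b' - b' * (1/r)) * X) / 2)
     = - 2 * s^2 / ((1 - s^2) * (s - r)) * (((b * s - b * r) * Y + (b' * (1/s) - b' * (1/r)) * X) / 2)"
proof -
  have s: "1 / (1 - 1/s) = - s / (1 - s)" "1 / (1 + 1/s) = s / (1 + s)"
    using assms by (auto simp: field_simps)
  have "(b - b * r) * Y + (b' - b' * (1/r)) * X = (1 - r) * (b * Y - b' * X / r)"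
    using assms(2) by (simp add: field_simps)
  then have m: "1 / (1 - r) * (((b - b * r) * Y + (b' - b' * (1/r)) * X) / 2) = (b * Y - b' * X / r) / 2"
    using assms(6) by simp
  have "(- b - b * r) * Y + (- b' - b' * (1/r)) * X = (1 + r) * (- (b * Y) - b' * X / r)"
    using assms(2) by (simp add: field_simps)
  then have p: "1 / (1 + r) * (((- b - b * r) * Y + (- b' - b' * (1/r)) * X) / 2) = (- (b * Y) - b' * X / r) / 2"
    using assms(7) by simp
  have d: "(b * s - b * r) * Y + (b' * (1/s) - b' * (1/r)) * X = (s - r) * (b * Y - b' * X / (s * r))"
    using assms(1,2) by (simp add: field_simps)
  have f: "1 - s^2 = (1 - s) * (1 + s)"
    by (simp add: algebra_simps power2_eq_square)
  have "- s * (1 + s) * (b * Y - b' * X / r) + s * (1 - s) * (b * Y + b' * X / r)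
      = - 2 * s^2 * (b * Y - b' * X / (s * r))"
    using assms(1,2) by (simp add: field_simps power2_eq_square)
  moreover have "- s / (1 - s) = - s * (1 + s) / (1 - s^2)" "s / (1 + s) = s * (1 - s) / (1 - s^2)"
    using assms(4,5) by (simp_all add: f)
  moreover have "A / D * ((u - w) / 2) - B / D * ((- u - w) / 2) = (A * (u - w) + B * (u + w)) / (D * 2)"
    for A B D u w :: complex
    by (simp add: divide_simps) (simp add: algebra_simps)
  ultimately have "- s / (1 - s) * ((b * Y - b' * X / r) / 2) - s / (1 + s) * ((- (b * Y) - b' * X / r) / 2)
     = - 2 * s^2 * (b * Y - b' * X / (s * r)) / ((1 - s^2) * 2)"
    by (simp only:)
  also have "\<dots> = - 2 * s^2 / (1 - s^2) * ((b * Y - b' * X / (s * r)) / 2)"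
    by simp
  also have "\<dots> = - 2 * s^2 / ((1 - s^2) * (s - r)) * (((s - r) * (b * Y - b' * X / (s * r))) / 2)"
    using assms(3) by simp
  finally show ?thesis
    unfolding d s using m p by (simp only: mult.assoc)
qed

text \<open>
  The diagonal terms, whose exponentials are constant, give the periods. Both quotients are
  pairings with \<open>b / (1 \<mp> cnj s)\<close>, and \<open>1 / (1 - cnj s) + 1 / (1 + cnj s) = 2 / (1 - (cnj s)\<^sup>2)\<close>, which on
  the unit circle equals \<open>1 - \<i> * Re s / Im s\<close>.
\<close>

lemma resonance_diagonal:
  fixes b s X :: complex
  assumes "cmod s = 1" "s \<noteq> 1" "s \<noteq> -1"
  shows "pairing (b - b * s) X / (cmod (1 - s))\<^sup>2 - pairing (- b - b * s) X / (cmod (1 + s))\<^sup>2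
    = pairing (b * (1 - \<i> * (Re s / Im s))) X"
proof -
  have n: "(Re s)\<^sup>2 + (Im s)\<^sup>2 = 1" using assms(1) by (simp add: cmod_def)
  have i: "Im s \<noteq> 0"
  proof
    assume "Im s = 0"
    then have "Re s = 1 \<or> Re s = -1" using n by (simp add: power2_eq_1_iff)
    then show False using assms \<open>Im s = 0\<close> by (auto simp: complex_eq_iff)
  qed
  have m: "(cmod (1 - s))\<^sup>2 = 2 - 2 * Re s" "(cmod (1 + s))\<^sup>2 = 2 + 2 * Re s"
    using n by (simp_all only: cmod_power2) (simp_all add: power2_eq_square algebra_simps)
  have q: "(2 - 2 * Re s) * (2 + 2 * Re s) = 4 * (Im s * Im s)"
    using n by (simp add: algebra_simps power2_eq_square)
  then have z: "2 - 2 * Re s \<noteq> 0" "2 + 2 * Re s \<noteq> 0"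
    using i by (metis mult_eq_0_iff zero_neq_numeral)+
  have "Im s / (2 + 2 * Re s) - Im s / (2 - 2 * Re s) = - (Im s * 4 * Re s) / ((2 - 2 * Re s) * (2 + 2 * Re s))"
    using z by (simp add: diff_frac_eq algebra_simps)
  also have "\<dots> = - Re s / Im s"
    unfolding q using i by (simp add: field_simps)
  finally have y: "Im s / (2 + 2 * Re s) - Im s / (2 - 2 * Re s) = - Re s / Im s" .
  have x: "(1 - Re s) / (2 - 2 * Re s) + (1 + Re s) / (2 + 2 * Re s) = 1"
    using z by (simp add: add_frac_eq) (simp add: algebra_simps)
  have c: "(1 - s) / complex_of_real (2 - 2 * Re s) + (1 + s) / complex_of_real (2 + 2 * Re s)
      = 1 - \<i> * (Re s / Im s)"
    using x y by (simp add: complex_eq_iff Re_divide_of_real Im_divide_of_real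
        del: of_real_diff of_real_add of_real_mult of_real_divide)
  have "pairing (b - b * s) X / (2 - 2 * Re s) - pairing (- b - b * s) X / (2 + 2 * Re s)
      = pairing (b * ((1 - s) / complex_of_real (2 - 2 * Re s) + (1 + s) / complex_of_real (2 + 2 * Re s))) X"
    using pairing_divide[of "b - b * s"  "2 - 2 * Re s" X] pairing_divide[of "- b - b * s" "2 + 2 * Re s" X]
      pairing_diff[of "(b - b * s) / complex_of_real (2 - 2 * Re s)" "(- b - b * s) / complex_of_real (2 + 2 * Re s)" X]
    by (simp add: algebra_simps add_divide_distrib diff_divide_distrib)
  then show ?thesis unfolding m c .
qed

text \<open>
  The double sum for \<open>cnj F' * dF - cnj G' * dG\<close> up to the constants of integration. Conjugation
  makes the frequencies \<open>\<plusminus>b\<close> cancel, so the contributions of the two planes to the index pair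
  \<open>(i, k)\<close> both carry the exponential of \<open>\<gamma> i - \<gamma> k\<close> and can be added. Off the diagonal the result is a
  differential, and the diagonal yields the parallel form. In the second summand the diagonal
  terms, whose coefficients are divided by zero, vanish because their frequency is \<open>0\<close>.
\<close>

lemma symplectic_pairing_expansion:
  assumes I: "finite I"
    and s: "inj_on s I" "\<And>i. i \<in> I \<Longrightarrow> cmod (s i) = 1 \<and> s i \<noteq> 1 \<and> s i \<noteq> -1"
    and q: "cmod q = 1"
    and \<gamma>_def: "\<And>i. \<gamma> i = b * s i"
  shows "cnj (trig_poly I (\<lambda>i. a i * (d i / (1 - s i))) (\<lambda>i. b - \<gamma> i) z)
        * trig_form I (\<lambda>i. d i / (1 - s i)) (\<lambda>i. b - \<gamma> i) z X
      - cnj (trig_poly I (\<lambda>i. a i * (q * d i / (1 + s i))) (\<lambda>i. - b - \<gamma> i) z)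
        * trig_form I (\<lambda>i. q * d i / (1 + s i)) (\<lambda>i. - b - \<gamma> i) z X
    = 2 * pi * \<i> * (\<Sum>i\<in>I. cnj (a i) * (cmod (d i))\<^sup>2 * pairing (b * (1 - \<i> * (Re (s i) / Im (s i)))) X)
      + trig_form (I \<times> I) (\<lambda>(i, k). cnj (a i * d i) * d k * (- 2 * (s i)\<^sup>2 / ((1 - (s i)\<^sup>2) * (s i - s k))))
          (\<lambda>(i, k). \<gamma> i - \<gamma> k) z X" (is "?L = ?R")
proof -
  \<comment> \<open>The factor \<open>q\<close> enters the second plane only through \<open>cnj q * q\<close>.\<close>
  have q1: "cnj q * q = 1" using q by (metis complex_norm_square mult.commute of_real_1 power_one)
  define br where "br i k = cnj (1 / (1 - s i)) * (1 / (1 - s k)) * pairing (b - \<gamma> k) X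
     - cnj (1 / (1 + s i)) * (1 / (1 + s k)) * pairing (- b - \<gamma> k) X" for i k
  have br: "br i k = (if i = k then complex_of_real (pairing (b * (1 - \<i> * (Re (s i) / Im (s i)))) X) else 0)
     + - 2 * (s i)\<^sup>2 / ((1 - (s i)\<^sup>2) * (s i - s k)) * pairing (\<gamma> i - \<gamma> k) X"
    if "i \<in> I" "k \<in> I" for i k
  proof (cases "i = k")
    case True
    have "br i i = complex_of_real (pairing (b - b * s i) X / (cmod (1 - s i))\<^sup>2
        - pairing (- b - b * s i) X / (cmod (1 + s i))\<^sup>2)"
      unfolding br_def \<gamma>_def of_real_diff of_real_divide complex_norm_square
      by (simp add: mult.commute)
    with resonance_diagonal[of "s i" b X] s(2)[OF that(1)] True show ?thesis by simp
  next
    case False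
    then have ne: "s i \<noteq> s k" using s(1) that by (auto dest: inj_onD)
    have c: "cnj (s j) = 1 / s j" "s j \<noteq> 0" "1 - s j \<noteq> 0" "1 + s j \<noteq> 0" if "j \<in> I" for j
    proof -
      show "s j \<noteq> 0" using s(2)[OF that] by auto
      moreover have "s j * cnj (s j) = 1" using s(2)[OF that] by (metis complex_norm_square of_real_1 power_one)
      ultimately show "cnj (s j) = 1 / s j" by (simp add: field_simps)
      show "1 - s j \<noteq> 0" "1 + s j \<noteq> 0" using s(2)[OF that] by (auto simp: add_eq_0_iff)
    qed
    show ?thesis using False resonance_off_diagonal[of "s i" "s k" b "cnj X" "cnj b" X] c[OF that(1)] c[OF that(2)] ne
      by (simp add: br_def \<gamma>_def pairing_of_real)
  qed
  have prod: "cnj (trig_poly I (\<lambda>i. a i * (v i)) (\<lambda>i. \<delta> - \<gamma> i) z) * trig_form I v (\<lambda>i. \<delta> - \<gamma> i) z X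
     = (\<Sum>(i,k)\<in>I \<times> I. 2 * pi * \<i> * e (\<gamma> i - \<gamma> k) z * (cnj (a i) * (cnj (v i) * v k * pairing (\<delta> - \<gamma> k) X)))" for v \<delta>
  proof -
    have ee: "e (\<gamma> i - \<gamma> k) z = cnj (e (\<delta> - \<gamma> i) z) * e (\<delta> - \<gamma> k) z" for i k
      by (simp add: cnj_e flip: e_add)
    show ?thesis
      unfolding trig_poly_def trig_form_def cnj_sum sum_product sum.cartesian_product ee
      by (intro sum.cong) (auto simp: mult_ac)
  qed
  have "?L = (\<Sum>(i,k)\<in>I \<times> I. 2 * pi * \<i> * e (\<gamma> i - \<gamma> k) z * (cnj (a i) * (cnj (d i) * d k * br i k)))"
    unfolding prod sum_subtractf[symmetric] br_def
  proof (intro sum.cong refl, clarify)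
    fix i k
    have Q: "cnj (q * d i / (1 + s i)) * (q * d k / (1 + s k)) * x
        = cnj (d i) * d k * (cnj (1 / (1 + s i)) * (1 / (1 + s k)) * x)" for x
      using q1 by (simp add: field_simps)
    show "2 * pi * \<i> * e (\<gamma> i - \<gamma> k) z
        * (cnj (a i) * (cnj (d i / (1 - s i)) * (d k / (1 - s k)) * pairing (b - \<gamma> k) X))
      - 2 * pi * \<i> * e (\<gamma> i - \<gamma> k) z
        * (cnj (a i) * (cnj (q * d i / (1 + s i)) * (q * d k / (1 + s k)) * pairing (- b - \<gamma> k) X))
      = 2 * pi * \<i> * e (\<gamma> i - \<gamma> k) z
        * (cnj (a i) * (cnj (d i) * d k * (cnj (1 / (1 - s i)) * (1 / (1 - s k)) * pairing (b - \<gamma> k) X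
     - cnj (1 / (1 + s i)) * (1 / (1 + s k)) * pairing (- b - \<gamma> k) X)))"
      unfolding Q by (simp add: right_diff_distrib)
  qed
  also have "\<dots> = (\<Sum>(i,k)\<in>I \<times> I. if i = k
        then 2 * pi * \<i> * (cnj (a i) * (cmod (d i))\<^sup>2 * pairing (b * (1 - \<i> * (Re (s i) / Im (s i)))) X) else 0)
     + trig_form (I \<times> I) (\<lambda>(i, k). cnj (a i * d i) * d k * (- 2 * (s i)\<^sup>2 / ((1 - (s i)\<^sup>2) * (s i - s k))))
          (\<lambda>(i, k). \<gamma> i - \<gamma> k) z X"
    unfolding trig_form_def sum.distrib[symmetric]
  proof (intro sum.cong refl, clarify)
    fix i k assume "i \<in> I" "k \<in> I"
    then show "2 * pi * \<i> * e (\<gamma> i - \<gamma> k) z * (cnj (a i) * (cnj (d i) * d k * br i k)) =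
      (if i = k
        then 2 * pi * \<i> * (cnj (a i) * (cmod (d i))\<^sup>2 * pairing (b * (1 - \<i> * (Re (s i) / Im (s i)))) X) else 0)
      + cnj (a i * d i) * d k * (- 2 * (s i)\<^sup>2 / ((1 - (s i)\<^sup>2) * (s i - s k)))
        * (2 * pi * \<i> * pairing (\<gamma> i - \<gamma> k) X * e (\<gamma> i - \<gamma> k) z)"
      unfolding br[OF \<open>i \<in> I\<close> \<open>k \<in> I\<close>]
      by (cases "i = k") (simp_all add: e_zero complex_norm_square mult_ac del: of_real_power)
  qed
  also have "(\<Sum>(i,k)\<in>I \<times> I. if i = k
        then 2 * pi * \<i> * (cnj (a i) * (cmod (d i))\<^sup>2 * pairing (b * (1 - \<i> * (Re (s i) / Im (s i)))) X) else 0)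
     = 2 * pi * \<i> * (\<Sum>i\<in>I. cnj (a i) * (cmod (d i))\<^sup>2 * pairing (b * (1 - \<i> * (Re (s i) / Im (s i)))) X)"
    using I by (simp add: sum.cartesian_product[symmetric] sum_distrib_left)
  finally show ?thesis .
qed

section \<open>Fourier coefficients of the torus\<close>

text \<open>
  As a function of its last column \<open>y\<close> the determinant is, up to the factor \<open>V\<close>, the divided
  difference of \<open>y\<close> at the nodes \<open>s j\<close>: both kill the columns of powers below \<open>N - 1\<close>. The cofactors
  \<open>cof j\<close> are found by testing with the values of the monic polynomial \<open>\<Prod>k\<noteq>j. x - s k\<close>, which vanishes
  at all nodes except the \<open>j\<close>-th, and \<open>V\<close> is the Vandermonde determinant, nonzero
  because a nonzero polynomial of degree below \<open>N\<close> does not have \<open>N\<close> roots.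
\<close>

lemma ex_det_eq_divided_difference:
  fixes s :: "nat \<Rightarrow> complex"
  assumes N: "N \<ge> 1" and s: "inj_on s {1..N}"
  shows "\<exists>V. V \<noteq> 0 \<and> (\<forall>y. Determinant.det (Matrix.mat N N (\<lambda>(i, k).
      if k < N - 1 then s (i + 1) ^ k else y (i + 1)))
    = V * (\<Sum>j=1..N. y j / (\<Prod>k\<in>{1..N} - {j}. s j - s k)))"
proof -
  define A where "A y = Matrix.mat N N (\<lambda>(i, k). if k < N - 1 then s (i + 1) ^ k else y (i + 1))" for y
  define V where "V = Determinant.det (A (\<lambda>j. s j ^ (N - 1)))"
  define cof where "cof j = cofactor (A (\<lambda>_. 0)) (j - 1) (N - 1)" for j
  have carr: "A y \<in> carrier_mat N N" for y by (simp add: A_def)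
  have cof: "cofactor (A y) i (N - 1) = cof (i + 1)" for y i
  proof -
    have "mat_delete (A y) i (N - 1) = mat_delete (A (\<lambda>_. 0)) i (N - 1)"
      by (rule eq_matI) (auto simp: mat_delete_def A_def)
    then show ?thesis by (simp add: cof_def cofactor_def)
  qed
  have det: "Determinant.det (A y) = (\<Sum>j=1..N. y j * cof j)" for y
  proof -
    have "Determinant.det (A y) = (\<Sum>i<N. A y $$ (i, N - 1) * cofactor (A y) i (N - 1))"
      using laplace_expansion_column[OF carr, of "N - 1"] N by simp
    also have "\<dots> = (\<Sum>i<N. y (i + 1) * cof (i + 1))"
      unfolding cof by (intro sum.cong refl) (simp add: A_def)
    also have "\<dots> = (\<Sum>j=1..N. y j * cof j)"
      by (rule sum.reindex_bij_witness[of _ "\<lambda>j. j - 1" "\<lambda>i. i + 1"]) auto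
    finally show ?thesis .
  qed
  have pow: "(\<Sum>j=1..N. s j ^ m * cof j) = (if m = N - 1 then V else 0)" if "m \<le> N - 1" for m
  proof (cases "m = N - 1")
    case True
    then show ?thesis using det[of "\<lambda>j. s j ^ (N - 1)"] by (simp add: V_def)
  next
    case False
    then have m: "m < N - 1" using that by simp
    have "Determinant.det (A (\<lambda>j. s j ^ m)) = 0"
    proof (rule Determinant.det_identical_columns[OF carr])
      show "m \<noteq> N - 1" "m < N" "N - 1 < N" using m by auto
      show "col (A (\<lambda>j. s j ^ m)) m = col (A (\<lambda>j. s j ^ m)) (N - 1)"
        by (rule eq_vecI) (use m in \<open>auto simp: A_def\<close>)
    qed
    then show ?thesis using False det[of "\<lambda>j. s j ^ m"] by simp
  qed
  have cofV: "cof j * (\<Prod>k\<in>{1..N} - {j}. s j - s k) = V" if j: "j \<in> {1..N}" for j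
  proof -
    define P where "P = (\<Prod>k\<in>{1..N} - {j}. [:- s k, 1:])"
    have poly: "poly P x = (\<Prod>k\<in>{1..N} - {j}. x - s k)" for x
      by (simp add: P_def poly_prod)
    have deg: "degree P = N - 1"
      unfolding P_def using j by (subst degree_prod_eq_sum_degree) auto
    have lead: "coeff P (N - 1) = 1"
      using lead_coeff_prod[of "\<lambda>k. [:- s k, 1:]" "{1..N} - {j}"] deg
      by (simp add: P_def)
    have "(\<Sum>m\<le>N - 1. coeff P m * (\<Sum>i=1..N. s i ^ m * cof i)) = (\<Sum>m\<le>N - 1. if m = N - 1 then V else 0)"
    proof (intro sum.cong refl)
      fix m assume "m \<in> {..N - 1}"
      then show "coeff P m * (\<Sum>i=1..N. s i ^ m * cof i) = (if m = N - 1 then V else 0)"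
        using pow[of m] lead by auto
    qed
    then have "V = (\<Sum>m\<le>N - 1. coeff P m * (\<Sum>i=1..N. s i ^ m * cof i))"
      by simp
    also have "\<dots> = (\<Sum>i=1..N. (\<Sum>m\<le>N - 1. coeff P m * s i ^ m) * cof i)"
      unfolding sum_distrib_left sum_distrib_right
      by (subst sum.swap) (simp add: mult.assoc)
    also have "\<dots> = (\<Sum>i=1..N. poly P (s i) * cof i)"
      by (simp add: poly_altdef deg)
    also have "\<dots> = (\<Sum>i=1..N. if i = j then poly P (s j) * cof j else 0)"
    proof (intro sum.cong refl)
      fix i assume i: "i \<in> {1..N}"
      show "poly P (s i) * cof i = (if i = j then poly P (s j) * cof j else 0)"
      proof (cases "i = j")
        case False
        then have "poly P (s i) = 0" unfolding poly using i by (intro prod_zero) auto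
        then show ?thesis using False by simp
      qed simp
    qed
    also have "\<dots> = poly P (s j) * cof j" using j by simp
    finally show ?thesis by (simp add: poly mult.commute)
  qed
  have "V \<noteq> 0"
  proof
    assume "V = 0"
    then obtain v where v: "v \<in> carrier_vec N" "v \<noteq> 0\<^sub>v N"
      "A (\<lambda>j. s j ^ (N - 1)) *\<^sub>v v = 0\<^sub>v N"
      using det_0_iff_vec_prod_zero[OF carr] unfolding V_def by blast
    \<comment> \<open>A kernel vector lists the coefficients of a polynomial that vanishes at all nodes.\<close>
    define P where "P = (\<Sum>k<N. monom (Matrix.vec_index v k) k)"
    have coeff: "coeff P k = (if k < N then Matrix.vec_index v k else 0)" for k
      by (simp add: P_def coeff_sum)
    have root: "poly P (s (i + 1)) = 0" if i: "i < N" for i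
    proof -
      have "poly P (s (i + 1)) = (\<Sum>k<N. Matrix.vec_index v k * s (i + 1) ^ k)"
        by (simp add: P_def poly_sum poly_monom)
      also have "\<dots> = (\<Sum>k<N. A (\<lambda>j. s j ^ (N - 1)) $$ (i, k) * Matrix.vec_index v k)"
      proof (intro sum.cong refl)
        fix k assume "k \<in> {..<N}"
        then have "k = N - 1" if "\<not> k < N - 1" using that by simp
        then show "Matrix.vec_index v k * s (i + 1) ^ k = A (\<lambda>j. s j ^ (N - 1)) $$ (i, k) * Matrix.vec_index v k"
          using i \<open>k \<in> {..<N}\<close> by (auto simp: A_def)
      qed
      also have "\<dots> = Matrix.vec_index (A (\<lambda>j. s j ^ (N - 1)) *\<^sub>v v) i"
        using i v(1) carr[of "\<lambda>j. s j ^ (N - 1)"] by (simp add: scalar_prod_def lessThan_atLeast0)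
      also have "\<dots> = 0" using v(3) i by simp
      finally show ?thesis .
    qed
    have "P \<noteq> 0"
    proof
      assume "P = 0"
      then have "Matrix.vec_index v k = 0" if "k < N" for k using coeff[of k] that by simp
      then have "v = 0\<^sub>v N" using v(1) by (intro eq_vecI) auto
      then show False using v(2) by simp
    qed
    moreover have "s ` {1..N} \<subseteq> {x. poly P x = 0}"
    proof clarify
      fix j assume "j \<in> {1..N}"
      then show "poly P (s j) = 0" using root[of "j - 1"] by auto
    qed
    ultimately have "card (s ` {1..N}) \<le> degree P"
      using card_mono[OF poly_roots_finite, of P "s ` {1..N}"] card_poly_roots_bound[of P]
      by linarith
    moreover have "degree P < N"
      using N by (intro degree_lessI) (auto simp: coeff)
    ultimately show False using s by (simp add: card_image)
  qed
  moreover have "Determinant.det (A y) = V * (\<Sum>j=1..N. y j / (\<Prod>k\<in>{1..N} - {j}. s j - s k))" for y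
    unfolding det sum_distrib_left
  proof (intro sum.cong refl)
    fix j assume j: "j \<in> {1..N}"
    have "(\<Prod>k\<in>{1..N} - {j}. s j - s k) \<noteq> 0"
      using s j by (auto dest: inj_onD)
    then show "y j * cof j = V * (y j / (\<Prod>k\<in>{1..N} - {j}. s j - s k))"
      using cofV[OF j] by (simp add: field_simps)
  qed
  ultimately show ?thesis unfolding A_def by blast
qed

lemma frequencies_uminus:
  assumes "\<beta>0 \<in> dual_lattice \<Gamma>" "\<gamma> \<in> frequencies \<Gamma> \<beta>0"
  shows "- \<gamma> \<in> frequencies \<Gamma> \<beta>0"
proof -
  obtain \<delta> where \<delta>: "\<delta> \<in> dual_lattice \<Gamma>" "\<gamma> = \<delta> + \<beta>0 / 2"
    using assms(2) by (auto simp: frequencies_def)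
  have "- \<gamma> = (- \<delta> - \<beta>0) + \<beta>0 / 2" by (simp add: \<delta>(2))
  moreover have "- \<delta> - \<beta>0 \<in> dual_lattice \<Gamma>"
    using \<delta>(1) assms(1) by (intro dual_lattice_diff dual_lattice_minus)
  ultimately have "\<exists>\<delta>\<in>dual_lattice \<Gamma>. - \<gamma> = \<delta> + \<beta>0 / 2" ..
  moreover have "cmod (- \<gamma>) = cmod \<beta>0 / 2" "- \<gamma> \<noteq> \<beta>0 / 2" "- \<gamma> \<noteq> - (\<beta>0 / 2)"
    using assms(2) by (auto simp: frequencies_def)
  ultimately show ?thesis unfolding frequencies_def by blast
qed

text \<open>
  The set of frequencies is symmetric under \<open>\<delta> \<mapsto> - \<delta>\<close>. Hence normalising the second plane by the value
  of the polynomial at \<open>1\<close> instead of \<open>-1\<close> costs only a unimodular factor, which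
  the symplectic form does not see.
\<close>

lemma norm_spec_poly_minus_one:
  assumes "\<beta>0 \<in> dual_lattice \<Gamma>" "bij_betw \<gamma> {1..N} (frequencies \<Gamma> \<beta>0)"
  shows "cmod (spec_poly N (spec \<beta>0 \<gamma>) (- 1)) = cmod (spec_poly N (spec \<beta>0 \<gamma>) 1)"
proof -
  have "bij_betw uminus (frequencies \<Gamma> \<beta>0) (frequencies \<Gamma> \<beta>0)"
    by (rule bij_betw_byWitness[where f' = uminus]) (auto intro: frequencies_uminus[OF assms(1)])
  then have "(\<Prod>\<delta>\<in>frequencies \<Gamma> \<beta>0. cmod (- 1 - 2 * \<delta> / \<beta>0))
      = (\<Prod>\<delta>\<in>frequencies \<Gamma> \<beta>0. cmod (- 1 - 2 * - \<delta> / \<beta>0))"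
    by (rule prod.reindex_bij_betw[symmetric])
  also have "\<dots> = (\<Prod>\<delta>\<in>frequencies \<Gamma> \<beta>0. cmod (1 - 2 * \<delta> / \<beta>0))"
    by (intro prod.cong refl) (simp add: norm_minus_commute)
  finally show ?thesis
    using prod.reindex_bij_betw[OF assms(2), of "\<lambda>\<delta>. cmod (- 1 - 2 * \<delta> / \<beta>0)"]
      prod.reindex_bij_betw[OF assms(2), of "\<lambda>\<delta>. cmod (1 - 2 * \<delta> / \<beta>0)"]
    by (simp add: spec_poly_def spec_def prod_norm)
qed

text \<open>
  The products \<open>\<Prod>k\<noteq>j. 1 - s k\<close> in \<open>\<phi>\<close> are quotients of the whole product by \<open>1 - s j\<close>; the division by
  \<open>p(1)\<close> therefore leaves the simple coefficients \<open>1 / (1 - s j)\<close> and, in the second plane,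
  \<open>q / (1 + s j)\<close>.
\<close>

lemma hsl_torus_eq_from_C2:
  assumes c: "\<And>y. Determinant.det (Matrix.mat N N (\<lambda>(i, k).
      if k < N - 1 then s (i + 1) ^ k else y (i + 1))) = (\<Sum>j=1..N. c j * y j)"
    and s: "s = spec \<beta>0 \<gamma>" and p: "spec_poly N s 1 \<noteq> 0" and "\<And>j. j \<in> {1..N} \<Longrightarrow> s j \<noteq> - 1"
    and q: "q = spec_poly N s (- 1) / spec_poly N s 1"
  defines "F \<equiv> \<lambda>t. trig_poly {1..N} (\<lambda>j. c j * t j / (1 - s j)) (\<lambda>j. \<beta>0 / 2 - \<gamma> j)"
    and "G \<equiv> \<lambda>t. trig_poly {1..N} (\<lambda>j. q * (c j * t j) / (1 + s j)) (\<lambda>j. - (\<beta>0 / 2) - \<gamma> j)"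
  shows "hsl_torus \<beta>0 N \<gamma> t z = from_C2 (F t z - F t 0) (G t z - G t 0)"
proof -
  have chi: "chi1 \<beta>0 N \<gamma> t x z = x * spec_poly N s x * (\<Sum>j=1..N. c j * (t j * e (- \<gamma> j) z / (x - s j)))" for x z
    using c[of "\<lambda>j. t j * e (- \<gamma> j) z / (x - s j)"] by (simp add: chi1_def phi_def s[symmetric])
  have F: "1 / spec_poly N s 1 * (chi1 \<beta>0 N \<gamma> t 1 z * e (\<beta>0 / 2) z) = F t z" for z
  proof -
    have "1 / spec_poly N s 1 * (chi1 \<beta>0 N \<gamma> t 1 z * e (\<beta>0 / 2) z)
        = (\<Sum>j=1..N. c j * (t j * e (- \<gamma> j) z / (1 - s j))) * e (\<beta>0 / 2) z"
      using p by (simp add: chi)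
    also have "\<dots> = F t z"
      unfolding F_def trig_poly_def sum_distrib_right
      by (intro sum.cong refl) (simp add: e_add[of "\<beta>0 / 2" "- \<gamma> _", simplified])
    finally show ?thesis .
  qed
  have G: "1 / spec_poly N s 1 * (chi1 \<beta>0 N \<gamma> t (- 1) z * e (- (\<beta>0 / 2)) z) = G t z" for z
  proof -
    have "1 / spec_poly N s 1 * (chi1 \<beta>0 N \<gamma> t (- 1) z * e (- (\<beta>0 / 2)) z)
        = (\<Sum>j=1..N. - q * (c j * (t j * e (- \<gamma> j) z / (- 1 - s j))) * e (- (\<beta>0 / 2)) z)"
      by (simp add: chi q sum_distrib_left sum_distrib_right sum_negf mult_ac)
    also have "\<dots> = G t z"
      unfolding G_def trig_poly_def
    proof (intro sum.cong refl)
      fix j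
      have "- 1 - s j = - (1 + s j)" by simp
      then show "- q * (c j * (t j * e (- \<gamma> j) z / (- 1 - s j))) * e (- (\<beta>0 / 2)) z
        = q * (c j * t j) / (1 + s j) * e (- (\<beta>0 / 2) - \<gamma> j) z"
        using e_add[of "- (\<beta>0 / 2)" "- \<gamma> j" z] by (simp only: divide_minus_right) simp
    qed
    finally show ?thesis .
  qed
  show ?thesis
    unfolding hsl_torus_def Re_Im_vec_frame_eq_from_C2 s[symmetric] right_diff_distrib
    using F[of z] F[of 0] G[of z] G[of 0] by (simp add: e_zero)
qed

section \<open>Periods of the variation\<close>

theorem theorem6p1:
  fixes \<Gamma> :: "complex set" and \<beta>0 :: complex and N :: nat
    and \<gamma> s t a :: "nat \<Rightarrow> complex"
    and f T :: "complex \<Rightarrow> real ^ 4"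
  assumes "is_lattice \<Gamma>"
    and "\<beta>0 \<in> dual_lattice \<Gamma>"
    and "frequencies \<Gamma> \<beta>0 \<noteq> {}"
    and "frequency_labelling \<Gamma> \<beta>0 N \<gamma>"
    and "s = spec \<beta>0 \<gamma>"
    and "\<exists>j\<in>{1..N}. t j \<noteq> 0"
    and "f = hsl_torus \<beta>0 N \<gamma> t"
    and "T = variation \<beta>0 N \<gamma> t a"
  shows "lagrangian_along \<Gamma> f T \<and>
    (hamiltonian_along \<Gamma> f T \<longleftrightarrow>
       (\<Sum>j=1..N. Re (a j) * (cmod (t j))\<^sup>2 / (\<Prod>k\<in>{1..N} - {j}. (cmod (s k - s j))\<^sup>2)) = 0 \<and>
       (\<Sum>j=1..N. Re (s j) / Im (s j) *
          (Re (a j) * (cmod (t j))\<^sup>2 / (\<Prod>k\<in>{1..N} - {j}. (cmod (s k - s j))\<^sup>2))) = 0)"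
proof -
  define b where "b = \<beta>0 / 2"
  define p where "p x = spec_poly N s x" for x
  define q where "q = p (- 1) / p 1"
  have bij: "bij_betw \<gamma> {1..N} (frequencies \<Gamma> \<beta>0)"
    using assms(4) by (simp add: frequency_labelling_def)
  then have mem: "\<gamma> j \<in> frequencies \<Gamma> \<beta>0" if "j \<in> {1..N}" for j
    using that by (auto simp: bij_betw_def)
  have "N \<ge> 1" using assms(6) by auto
  have b0: "\<beta>0 \<noteq> 0" using mem[of 1] \<open>N \<ge> 1\<close> by (auto simp: frequencies_def)
  have \<gamma>s: "\<gamma> j = b * s j" for j using b0 by (simp add: assms(5) spec_def b_def)
  have s: "cmod (s j) = 1 \<and> s j \<noteq> 1 \<and> s j \<noteq> - 1" if "j \<in> {1..N}" for j
  proof -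
    have "cmod (\<gamma> j) = cmod b * cmod (s j)" by (simp add: \<gamma>s norm_mult)
    moreover have "cmod (\<gamma> j) = cmod b" "\<gamma> j \<noteq> b" "\<gamma> j \<noteq> - b"
      using mem[OF that] by (simp_all add: frequencies_def b_def norm_divide)
    ultimately show ?thesis using b0 by (auto simp: \<gamma>s b_def)
  qed
  have inj: "inj_on s {1..N}"
  proof (rule inj_onI)
    fix i j assume ij: "i \<in> {1..N}" "j \<in> {1..N}" "s i = s j"
    then have "\<gamma> i = \<gamma> j" by (simp only: \<gamma>s)
    with ij show "i = j" using bij by (metis bij_betw_imp_inj_on inj_onD)
  qed
  have dual: "b - \<gamma> j \<in> dual_lattice \<Gamma>" "- b - \<gamma> j \<in> dual_lattice \<Gamma>" if j: "j \<in> {1..N}" for j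
  proof -
    obtain \<delta> where \<delta>: "\<delta> \<in> dual_lattice \<Gamma>" "\<gamma> j = \<delta> + b"
      using mem[OF j] by (auto simp: frequencies_def b_def)
    have "b - \<gamma> j = - \<delta>" "- b - \<gamma> j = - \<delta> - \<beta>0" using \<delta>(2) by (simp_all add: b_def)
    then show "b - \<gamma> j \<in> dual_lattice \<Gamma>" "- b - \<gamma> j \<in> dual_lattice \<Gamma>"
      using \<delta>(1) assms(2) by (simp_all add: dual_lattice_diff dual_lattice_minus)
  qed
  have dual': "\<gamma> j - \<gamma> k \<in> dual_lattice \<Gamma>" if "j \<in> {1..N}" "k \<in> {1..N}" for j k
    using dual_lattice_diff[OF dual(1)[OF that(2)] dual(1)[OF that(1)]] by simp
  have p1: "p 1 \<noteq> 0"
    using s by (auto simp: p_def spec_poly_def)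
  have q: "cmod q = 1"
    using norm_spec_poly_minus_one[OF assms(2) bij] p1
    by (simp add: q_def p_def norm_divide flip: assms(5))
  obtain V where V: "V \<noteq> 0" "\<And>y. Determinant.det (Matrix.mat N N (\<lambda>(i, k).
      if k < N - 1 then s (i + 1) ^ k else y (i + 1)))
    = V * (\<Sum>j=1..N. y j / (\<Prod>k\<in>{1..N} - {j}. s j - s k))"
    using ex_det_eq_divided_difference[OF \<open>N \<ge> 1\<close> inj] by blast
  define c where "c j = V / (\<Prod>k\<in>{1..N} - {j}. s j - s k)" for j
  define d where "d j = c j * t j" for j
  define W where "W j = Re (a j) * (cmod (t j))\<^sup>2 / (\<Prod>k\<in>{1..N} - {j}. (cmod (s k - s j))\<^sup>2)" for j
  have W: "Re (a j) * (cmod (d j))\<^sup>2 = (cmod V)\<^sup>2 * W j" for j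
    by (simp add: d_def c_def W_def norm_mult norm_divide power_mult_distrib power_divide
        norm_minus_commute flip: prod_norm prod_power_distrib)
  let ?F = "\<lambda>u. trig_poly {1..N} (\<lambda>j. u j / (1 - s j)) (\<lambda>j. b - \<gamma> j)"
  let ?G = "\<lambda>u. trig_poly {1..N} (\<lambda>j. q * u j / (1 + s j)) (\<lambda>j. - b - \<gamma> j)"
  let ?DF = "trig_form {1..N} (\<lambda>j. d j / (1 - s j)) (\<lambda>j. b - \<gamma> j)"
  let ?DG = "trig_form {1..N} (\<lambda>j. q * d j / (1 + s j)) (\<lambda>j. - b - \<gamma> j)"
  let ?E = "\<lambda>u z. from_C2 (?F u z - ?F u 0) (?G u z - ?G u 0)"
  have torus: "hsl_torus \<beta>0 N \<gamma> t' z = ?E (\<lambda>j. c j * t' j) z" for t' z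
    unfolding b_def
  proof (rule hsl_torus_eq_from_C2[where s = s])
    show "Determinant.det (Matrix.mat N N (\<lambda>(i, k).
      if k < N - 1 then s (i + 1) ^ k else y (i + 1))) = (\<Sum>j=1..N. c j * y j)" for y
      unfolding V(2) by (simp add: sum_distrib_left c_def)
  qed (use p1 s q_def assms(5) in \<open>simp_all add: p_def\<close>)
  have f: "f z = ?E d z" for z
    by (simp add: assms(7) torus d_def)
  have T: "T z = ?E (\<lambda>j. a j * d j) z" for z
  proof -
    have "((\<lambda>r::real. trig_poly {1..N} (\<lambda>j. w j * d j * exp (of_real r * a j)) \<delta> z
           - trig_poly {1..N} (\<lambda>j. w j * d j * exp (of_real r * a j)) \<delta> 0) has_vector_derivative
         trig_poly {1..N} (\<lambda>j. a j * (w j * d j)) \<delta> z - trig_poly {1..N} (\<lambda>j. a j * (w j * d j)) \<delta> 0) (at 0)" for w \<delta>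
      by (intro has_vector_derivative_diff has_vector_derivative_trig_poly_exp)
    from bounded_linear.has_vector_derivative[OF bounded_linear_from_C2 has_vector_derivative_Pair[OF
      this[of "\<lambda>j. 1 / (1 - s j)" "\<lambda>j. b - \<gamma> j"] this[of "\<lambda>j. q / (1 + s j)" "\<lambda>j. - b - \<gamma> j"]]]
    have "((\<lambda>r::real. ?E (\<lambda>j. c j * (t j * exp (of_real r * a j))) z) has_vector_derivative
      ?E (\<lambda>j. a j * d j) z) (at 0)"
      by (simp add: d_def mult_ac)
    then show ?thesis unfolding assms(8) variation_def torus by (rule vector_derivative_at)
  qed
  have has_derivative_E: "(?E u has_derivative (\<lambda>X. from_C2
     (trig_form {1..N} (\<lambda>j. u j / (1 - s j)) (\<lambda>j. b - \<gamma> j) z X)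
     (trig_form {1..N} (\<lambda>j. q * u j / (1 + s j)) (\<lambda>j. - b - \<gamma> j) z X))) (at z)" for u z
  proof -
    have "((\<lambda>z. trig_poly I w \<delta> z - trig_poly I w \<delta> 0) has_derivative trig_form I w \<delta> z) (at z)" for I :: "nat set" and w \<delta>
      using has_derivative_diff[OF has_derivative_trig_poly has_derivative_const] by simp
    from bounded_linear.has_derivative[OF bounded_linear_from_C2 has_derivative_Pair[OF this this]]
    show ?thesis by simp
  qed
  have per: "trig_poly {1..N} w (\<lambda>j. b - \<gamma> j) (z + v) = trig_poly {1..N} w (\<lambda>j. b - \<gamma> j) z"
    "trig_poly {1..N} w (\<lambda>j. - b - \<gamma> j) (z + v) = trig_poly {1..N} w (\<lambda>j. - b - \<gamma> j) z"
    "trig_poly ({1..N} \<times> {1..N}) w' (\<lambda>(i, k). \<gamma> i - \<gamma> k) (z + v)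
      = trig_poly ({1..N} \<times> {1..N}) w' (\<lambda>(i, k). \<gamma> i - \<gamma> k) z" if v: "v \<in> \<Gamma>" for w w' z v
    by (rule trig_poly_periodic[OF _ v]; auto intro: dual dual')+
  have torus_E: "torus_map \<Gamma> (?E u)" for u
    unfolding torus_map_def
  proof (intro conjI allI ballI)
    show "?E u differentiable at z" for z
      using has_derivative_E by (rule differentiableI)
    show "?E u (z + w) = ?E u z" if "w \<in> \<Gamma>" for z w
      by (simp only: per[OF that])
  qed
  \<comment> \<open>The additive constants of \<open>F'\<close> and \<open>G'\<close>, which make \<open>T\<close> vanish at \<open>0\<close>; by themselves they contribute
    multiples of \<open>dF\<close> and \<open>dG\<close> to \<open>\<sigma>\<close>.\<close>
  define k1 where "k1 = ?F (\<lambda>j. a j * d j) 0"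
  define k2 where "k2 = ?G (\<lambda>j. a j * d j) 0"
  define C where "C = (\<lambda>(i, k). 2 * (cnj (a i * d i) * d k * (- 2 * (s i)\<^sup>2 / ((1 - (s i)\<^sup>2) * (s i - s k)))))"
  \<comment> \<open>The period covector: the factor \<open>2 * pi * \<i>\<close> of the diagonal terms turns their imaginary part into
    a real part, which retains only \<open>Re (a j)\<close>.\<close>
  define \<zeta> where "\<zeta> = of_real (4 * pi) * b
    * (\<Sum>j=1..N. of_real (Re (a j) * (cmod (d j))\<^sup>2) * (1 - \<i> * (Re (s j) / Im (s j))))"
  let ?A = "trig_form ({1..N} \<times> {1..N}) C (\<lambda>(i, k). \<gamma> i - \<gamma> k)"
  let ?B1 = "trig_form {1..N} (\<lambda>j. - 2 * cnj k1 * (d j / (1 - s j))) (\<lambda>j. b - \<gamma> j)"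
  let ?B2 = "trig_form {1..N} (\<lambda>j. 2 * cnj k2 * (q * d j / (1 + s j))) (\<lambda>j. - b - \<gamma> j)"
  have sigma: "sigma_form f T = (\<lambda>z X. pairing \<zeta> X + (Im (?A z X) + (Im (?B1 z X) + Im (?B2 z X))))"
  proof (intro ext)
    fix z X
    have "frechet_derivative f (at z) = (\<lambda>X. from_C2 (?DF z X) (?DG z X))"
      using has_derivative_E[of d z] by (simp add: frechet_derivative_at[symmetric] f[abs_def])
    then have "sigma_form f T z X = omega (?E (\<lambda>j. a j * d j) z) (from_C2 (?DF z X) (?DG z X))"
      by (simp add: sigma_form_def T)
    also have "\<dots> = 2 * Im (cnj (?F (\<lambda>j. a j * d j) z) * ?DF z X - cnj (?G (\<lambda>j. a j * d j) z) * ?DG z X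
        - cnj k1 * ?DF z X + cnj k2 * ?DG z X)"
      unfolding omega_from_C2 k1_def k2_def
      by (simp only: complex_cnj_diff) (simp only: algebra_simps)
    also have "cnj (?F (\<lambda>j. a j * d j) z) * ?DF z X - cnj (?G (\<lambda>j. a j * d j) z) * ?DG z X
       = 2 * pi * \<i> * (\<Sum>j=1..N. cnj (a j) * (cmod (d j))\<^sup>2 * pairing (b * (1 - \<i> * (Re (s j) / Im (s j)))) X)
         + trig_form ({1..N} \<times> {1..N}) (\<lambda>(i, k). cnj (a i * d i) * d k * (- 2 * (s i)\<^sup>2 / ((1 - (s i)\<^sup>2) * (s i - s k))))
          (\<lambda>(i, k). \<gamma> i - \<gamma> k) z X"
      using symplectic_pairing_expansion[OF _ inj s q \<gamma>s, of a d z X] by (simp add: mult_ac)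
    also have "2 * Im (2 * pi * \<i> * (\<Sum>j=1..N. cnj (a j) * (cmod (d j))\<^sup>2 * pairing (b * (1 - \<i> * (Re (s j) / Im (s j)))) X)
         + trig_form ({1..N} \<times> {1..N}) (\<lambda>(i, k). cnj (a i * d i) * d k * (- 2 * (s i)\<^sup>2 / ((1 - (s i)\<^sup>2) * (s i - s k))))
          (\<lambda>(i, k). \<gamma> i - \<gamma> k) z X - cnj k1 * ?DF z X + cnj k2 * ?DG z X)
       = 2 * Im (2 * pi * \<i> * (\<Sum>j=1..N. cnj (a j) * (cmod (d j))\<^sup>2 * pairing (b * (1 - \<i> * (Re (s j) / Im (s j)))) X))
         + (Im (?A z X) + (Im (?B1 z X) + Im (?B2 z X)))"
    proof -
      have "?A z X = 2 * trig_form ({1..N} \<times> {1..N}) (\<lambda>(i, k). cnj (a i * d i) * d k * (- 2 * (s i)\<^sup>2 / ((1 - (s i)\<^sup>2) * (s i - s k))))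
          (\<lambda>(i, k). \<gamma> i - \<gamma> k) z X"
        unfolding trig_form_scale C_def
        by (rule arg_cong[where f = "\<lambda>c. trig_form _ c _ z X"]) (simp add: fun_eq_iff)
      moreover have "?B1 z X = - 2 * cnj k1 * ?DF z X" "?B2 z X = 2 * cnj k2 * ?DG z X"
        unfolding trig_form_scale by (rule refl)+
      ultimately show ?thesis by (simp add: algebra_simps)
    qed
    also have "2 * Im (2 * pi * \<i> * (\<Sum>j=1..N. cnj (a j) * (cmod (d j))\<^sup>2 * pairing (b * (1 - \<i> * (Re (s j) / Im (s j)))) X))
        = pairing \<zeta> X"
    proof -
      have "pairing \<zeta> X = (\<Sum>j=1..N. 4 * pi * (Re (a j) * (cmod (d j))\<^sup>2 * pairing (b * (1 - \<i> * (Re (s j) / Im (s j)))) X))"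
        unfolding \<zeta>_def by (rule pairing_of_real_combination)
      moreover have "Im (2 * pi * \<i> * S) = 2 * pi * Re S" for S
        by simp
      moreover have "Re (cnj x * (complex_of_real r)\<^sup>2 * complex_of_real y) = Re x * r\<^sup>2 * y" for x r y
        by (simp flip: of_real_power)
      ultimately show ?thesis by (simp add: sum_distrib_left mult_ac del: of_real_power)
    qed
    finally show "sigma_form f T z X = pairing \<zeta> X + (Im (?A z X) + (Im (?B1 z X) + Im (?B2 z X)))" .
  qed
  have closed: "closed_form (sigma_form f T)"
    unfolding sigma
    by (intro closed_form_add closed_form_parallel closed_form_Im_trig_form)
  let ?P = "\<lambda>z. Im (trig_poly ({1..N} \<times> {1..N}) C (\<lambda>(i, k). \<gamma> i - \<gamma> k) z)
    + (Im (trig_poly {1..N} (\<lambda>j. - 2 * cnj k1 * (d j / (1 - s j))) (\<lambda>j. b - \<gamma> j) z)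
     + Im (trig_poly {1..N} (\<lambda>j. 2 * cnj k2 * (q * d j / (1 + s j))) (\<lambda>j. - b - \<gamma> j) z))"
  have exact: "exact_on_torus \<Gamma> (sigma_form f T) \<longleftrightarrow> \<zeta> = 0"
  proof (rule exact_on_torus_iff[OF assms(1)])
    show "sigma_form f T z = (\<lambda>X. pairing \<zeta> X + (Im (?A z X) + (Im (?B1 z X) + Im (?B2 z X))))" for z
      unfolding sigma ..
    show "(?P has_derivative (\<lambda>X. Im (?A z X) + (Im (?B1 z X) + Im (?B2 z X)))) (at z)" for z
      by (intro has_derivative_add has_derivative_Im has_derivative_trig_poly)
    show "?P (z + w) = ?P z" if "w \<in> \<Gamma>" for z w
      by (simp only: per[OF that])
  qed
  have "\<zeta> = 4 * pi * b * (cmod V)\<^sup>2 * ((\<Sum>j=1..N. W j) - \<i> * (\<Sum>j=1..N. Re (s j) / Im (s j) * W j))"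
  proof -
    have "\<zeta> = 4 * pi * b * (cmod V)\<^sup>2 * (\<Sum>j=1..N. W j - \<i> * (Re (s j) / Im (s j) * W j))"
      unfolding \<zeta>_def W by (simp add: sum_distrib_left right_diff_distrib mult_ac)
    then show ?thesis by (simp add: sum_subtractf sum_distrib_left)
  qed
  moreover have "complex_of_real x - \<i> * complex_of_real y = 0 \<longleftrightarrow> x = 0 \<and> y = 0" for x y
    by (simp add: complex_eq_iff)
  ultimately have "\<zeta> = 0 \<longleftrightarrow> (\<Sum>j=1..N. W j) = 0 \<and> (\<Sum>j=1..N. Re (s j) / Im (s j) * W j) = 0"
    using V(1) b0 by (simp add: b_def del: of_real_sum)
  moreover have "torus_map \<Gamma> f" "torus_map \<Gamma> T"
    using torus_E[of d] torus_E[of "\<lambda>j. a j * d j"] by (simp_all add: f[abs_def] T[abs_def])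
  ultimately show ?thesis
    using closed exact by (simp add: lagrangian_along_def hamiltonian_along_def W_def)
qed

end
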